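(* Let $p$ be an odd prime, let $s,h,t,r$ be positive integers with $r$ odd, $t\mid h$, $s\le h$, $\gcd(r,p)=1$, and let $q=p^h$. Assume that $\mathbb{F}_q$ is the splitting field of $g(x)=x^{rp^s}+ax^{rp^s-1}+bx^{rp^s-2}+c\in\mathbb{F}_{p^t}[x]$ with $a,b,c\ne0$, and that $\alpha_1,\dots,\alpha_{rp^s}$ are all the roots of $g(x)$, pairwise distinct. Let $v_i\in\mathbb{F}_{q^2}$ be such that $v_i^2=(g'(\alpha_i))^{-1}$ for $1\le i\le rp^s$ (such $v_i$ exist), and put $\boldsymbol{\alpha}=(\alpha_1,\dots,\alpha_{rp^s})$, $\boldsymbol{v}=(v_1,\dots,v_{rp^s})$. Let $\eta_2=2b^{-1}$, $\eta_1=2ab^{-1}$, $k=\frac{rp^s-1}{2}$, $$\mathcal{S}_1=\Big\{\sum_{i=0}^{k-1}f_ix^i+f_{k-1}\big(\eta_1x^{k}+\eta_2x^{k+1}\big): f_i\in\mathbb{F}_{q^2}\text{ for }0\le i\le k-1\Big\},$$ and $\mathcal{C}_1=ev_{\boldsymbol{\alpha},\boldsymbol{v}}(\mathcal{S}_1)$. Suppose that for every $k$-subset $I$ of $\{1,\dots,rp^s\}$ one has $\eta_1c_1+\eta_2(c_2-c_1^2)\neq1$, where $c_j$ denotes the coefficient of $x^{k-j}$ in $\prod_{i\in I}(x-\alpha_i)$. Then there exists a $[rp^s,\,\frac{rp^s-1}{2},\,\frac{rp^s+3}{2}]_{q^2}$ self-orthogonal MDS TGRS code.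
   Context: For $\boldsymbol{\alpha}\in\mathbb{F}^n$ with distinct entries and $\boldsymbol{v}\in(\mathbb{F}^* )^n$ ($\mathbb{F}$ a finite field; here $\mathbb{F}=\mathbb{F}_{q^2}$), $ev_{\boldsymbol{\alpha},\boldsymbol{v}}(f)=(v_1f(\alpha_1),\dots,v_nf(\alpha_n))$ for $f\in\mathbb{F}[x]$. For a $k\times(n-k)$ matrix $(\eta_{ij})$ over $\mathbb{F}$, the twisted generalized Reed-Solomon (TGRS) code is the image under $ev_{\boldsymbol{\alpha},\boldsymbol{v}}$ of $\{\sum_{i=0}^{k-1}f_ix^i+\sum_{i=0}^{k-1}f_i\sum_{j=1}^{n-k}\eta_{i+1,j}x^{k-1+j}:f_i\in\mathbb{F}\}$. An $[n,k,d]_{Q}$ code is a linear code over $\mathbb{F}_{Q}$ of length $n$, dimension $k$ and minimum Hamming distance $d$; it is MDS if $d=n-k+1$. A code $\mathcal{C}$ is self-orthogonal if $\mathcal{C}\subseteq\mathcal{C}^\perp$ for the Euclidean inner product. *)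

theory Defs
  imports
    "HOL-Analysis.Analysis"
    "HOL-Computational_Algebra.Computational_Algebra"
begin

definition is_subfield :: "'a::field set \<Rightarrow> bool" where
  "is_subfield K \<longleftrightarrow>
     0 \<in> K \<and> 1 \<in> K \<and>
     (\<forall>x\<in>K. \<forall>y\<in>K. x + y \<in> K \<and> x * y \<in> K) \<and>
     (\<forall>x\<in>K. - x \<in> K \<and> inverse x \<in> K)"

definition poly_over :: "'a::field set \<Rightarrow> 'a poly \<Rightarrow> bool" where
  "poly_over K f \<longleftrightarrow> (\<forall>i. coeff f i \<in> K)"

definition splits_in :: "'a::field set \<Rightarrow> 'a poly \<Rightarrow> bool" where
  "splits_in L f \<longleftrightarrow>
     (\<exists>A. set_mset A \<subseteq> L \<and> f = smult (lead_coeff f) (\<Prod>x\<in>#A. [:- x, 1:]))"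

text \<open>
  All fields live inside the ambient field given by the type; the hull is the subfield
  generated over \<open>K\<close> by the roots of \<open>f\<close> in \<open>L\<close>.
\<close>

definition is_splitting_field :: "'a::field set \<Rightarrow> 'a set \<Rightarrow> 'a poly \<Rightarrow> bool" where
  "is_splitting_field K L f \<longleftrightarrow>
     is_subfield K \<and> is_subfield L \<and> K \<subseteq> L \<and> poly_over K f \<and> splits_in L f \<and>
     is_subfield hull (K \<union> {x \<in> L. poly f x = 0}) = L"

text \<open>A code of length \<open>n\<close> is a set of vectors \<open>'a ^ 'n\<close> with \<open>CARD('n) = n\<close>.\<close>

definition hamming_dist :: "'a ^ 'n \<Rightarrow> 'a ^ 'n \<Rightarrow> nat" where
  "hamming_dist x y = card {i. x $ i \<noteq> y $ i}"

text \<open>Only meaningful for codes with at least two words (otherwise an infimum of the empty set).\<close>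

definition min_dist :: "('a ^ 'n) set \<Rightarrow> nat" where
  "min_dist C = Inf {hamming_dist x y | x y. x \<in> C \<and> y \<in> C \<and> x \<noteq> y}"

definition is_code :: "nat \<Rightarrow> nat \<Rightarrow> nat \<Rightarrow> ('a::field ^ 'n) set \<Rightarrow> bool" where
  "is_code n k d C \<longleftrightarrow>
     CARD('n) = n \<and> vec.subspace C \<and> vec.dim C = k \<and> min_dist C = d"

definition is_MDS :: "('a::field ^ 'n) set \<Rightarrow> bool" where
  "is_MDS C \<longleftrightarrow> (\<exists>n k d. is_code n k d C \<and> d = n - k + 1)"

definition dual_code :: "('a::field ^ 'n) set \<Rightarrow> ('a ^ 'n) set" where
  "dual_code C = {y. \<forall>x\<in>C. scalar_product x y = 0}"

definition self_orthogonal :: "('a::field ^ 'n) set \<Rightarrow> bool" where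
  "self_orthogonal C \<longleftrightarrow> C \<subseteq> dual_code C"

definition ev :: "'a::field ^ 'n \<Rightarrow> 'a ^ 'n \<Rightarrow> 'a poly \<Rightarrow> 'a ^ 'n" where
  "ev \<alpha> v f = (\<chi> i. v $ i * poly f (\<alpha> $ i))"

text \<open>The matrix \<open>\<eta>\<close> is indexed from 1; only its entries with row in \<open>{1..k}\<close> and column in
  \<open>{1..n-k}\<close> occur.\<close>

definition twisted_polys :: "nat \<Rightarrow> nat \<Rightarrow> (nat \<Rightarrow> nat \<Rightarrow> 'a) \<Rightarrow> 'a::field poly set" where
  "twisted_polys n k \<eta> =
     {(\<Sum>i<k. monom (f i) i) +
      (\<Sum>i<k. smult (f i) (\<Sum>j=1..n-k. monom (\<eta> (i + 1) j) (k - 1 + j))) | f. True}"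

definition is_TGRS :: "nat \<Rightarrow> ('a::field ^ 'n) set \<Rightarrow> bool" where
  "is_TGRS k C \<longleftrightarrow>
     k \<le> CARD('n) \<and>
     (\<exists>(\<alpha> :: 'a ^ 'n) v \<eta>. inj (($) \<alpha>) \<and> (\<forall>i. v $ i \<noteq> 0) \<and>
        C = ev \<alpha> v ` twisted_polys CARD('n) k \<eta>)"

definition self_orthogonal_MDS_TGRS ::
    "nat \<Rightarrow> nat \<Rightarrow> nat \<Rightarrow> ('a::field ^ 'n) set \<Rightarrow> bool" where
  "self_orthogonal_MDS_TGRS n k d C \<longleftrightarrow>
     is_code n k d C \<and> self_orthogonal C \<and> is_MDS C \<and> is_TGRS k C"

text \<open>The coefficient of \<open>x ^ (k - j)\<close> in the product of the \<open>x - \<alpha>\<^sub>i\<close>, \<open>i \<in> I\<close>, where the exponent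
  \<open>k - j\<close> is an integer: the coefficient is 0 if \<open>j > k\<close> (this happens for \<open>k = 1\<close>, \<open>j = 2\<close>).\<close>

definition locator_coeff :: "'a::field ^ 'n \<Rightarrow> nat \<Rightarrow> 'n set \<Rightarrow> nat \<Rightarrow> 'a" where
  "locator_coeff \<alpha> k I j =
     (if j \<le> k then coeff (\<Prod>i\<in>I. [:- (\<alpha> $ i), 1:]) (k - j) else 0)"

end

theory Submission
  imports Defs
begin

text \<open>
  Put \<open>n = 2 k + 1\<close>. Lagrange interpolation gives \<open>\<Sum>\<^sub>i F(\<alpha>\<^sub>i) / g'(\<alpha>\<^sub>i) = coeff F (n - 1)\<close> when
  \<open>degree F < n\<close>. Since \<open>v\<^sub>i\<^sup>2 = 1 / g'(\<alpha>\<^sub>i)\<close>, the inner product of the words of \<open>F\<close> and \<open>G\<close> is the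
  coefficient of \<open>x\<^bsup>n-1\<^esup>\<close> in \<open>F G mod g\<close>; only the top three coefficients of \<open>F G\<close> contribute,
  all of them multiples of \<open>y = coeff F (k - 1) * coeff G (k - 1)\<close>, and the total is \<open>y\<close> times
  \<open>\<eta>\<^sub>2\<^sup>2 (a\<^sup>2 - b) - 2 a \<eta>\<^sub>1 \<eta>\<^sub>2 + \<eta>\<^sub>1\<^sup>2 + 2 \<eta>\<^sub>2 = 0\<close>. A nonzero \<open>F \<in> S\<^sub>1\<close> has degree at most \<open>k + 1\<close>, and
  the hypothesis on \<open>k\<close>-subsets says exactly that it cannot vanish at \<open>k\<close> of the \<open>\<alpha>\<^sub>i\<close>. The \<open>v\<^sub>i\<close>
  exist because every element of the subfield of order \<open>q\<close> is a square in the field of order \<open>q\<^sup>2\<close>.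
\<close>

section \<open>Powers and square roots in finite fields\<close>

lemma card_power_eq_le:
  fixes z :: "'a::field"
  assumes "m > 0"
  shows "card {y. y ^ m = z} \<le> m"
proof -
  define f where "f = monom 1 m - [:z:]"
  have deg: "degree f = m"
    unfolding f_def using assms
    by (subst diff_conv_add_uminus, subst degree_add_eq_left) (auto simp: degree_monom_eq)
  then have "f \<noteq> 0" using assms by auto
  have "{y. y ^ m = z} \<subseteq> {y. poly f y = 0}"
    by (auto simp: f_def poly_monom)
  then have "card {y. y ^ m = z} \<le> card {y. poly f y = 0}"
    using poly_roots_finite[OF \<open>f \<noteq> 0\<close>] by (rule card_mono[rotated])
  also have "\<dots> \<le> m"
    using card_poly_roots_bound[OF \<open>f \<noteq> 0\<close>] deg by simp
  finally show ?thesis .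
qed

text \<open>Multiplication by \<open>x\<close> permutes \<open>L - {0}\<close>, so the product of
  all nonzero elements is unchanged when each factor is multiplied by \<open>x\<close>; cancelling
  that product leaves the power of \<open>x\<close>.\<close>

lemma subfield_power_card:
  fixes L :: "'a::{field,finite} set"
  assumes L: "is_subfield L" and x: "x \<in> L" "x \<noteq> 0"
  shows "x ^ (card L - 1) = 1"
proof -
  have "bij_betw ((*) x) (L - {0}) (L - {0})"
  proof (rule bij_betw_byWitness[where f' = "(*) (inverse x)"])
    have "inverse x \<in> L" using L x by (auto simp: is_subfield_def)
    then show "(*) x ` (L - {0}) \<subseteq> L - {0}" "(*) (inverse x) ` (L - {0}) \<subseteq> L - {0}"
      using L x unfolding is_subfield_def by auto
  qed (use x in \<open>auto simp: field_simps\<close>)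
  then have "(\<Prod>y\<in>L - {0}. x * y) = (\<Prod>y\<in>L - {0}. y)"
    by (rule prod.reindex_bij_betw)
  then have "x ^ card (L - {0}) * (\<Prod>y\<in>L - {0}. y) = (\<Prod>y\<in>L - {0}. y)"
    by (simp add: prod.distrib)
  moreover have "(\<Prod>y\<in>L - {0}. y) \<noteq> 0" by simp
  moreover have "card (L - {0}) = card L - 1"
    using L by (intro card_Diff_singleton) (auto simp: is_subfield_def)
  ultimately show ?thesis by simp
qed

text \<open>Euler's criterion: the nonzero squares fill up the group of \<open>m\<close>-th roots of unity,
  \<open>m = (CARD('a) - 1) div 2\<close>, by counting.\<close>

lemma square_root_exists:
  fixes x :: "'a::{field,finite}"
  assumes card: "CARD('a) = 2 * m + 1" and x: "x ^ m = 1"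
  shows "\<exists>y. y ^ 2 = x"
proof -
  define S :: "'a set" where "S = (\<lambda>y. y\<^sup>2) ` (UNIV - {0})"
  have "card {0, 1 :: 'a} \<le> CARD('a)" by (rule card_mono) auto
  then have m: "m > 0" using card by simp
  \<comment> \<open>The fibres of squaring over \<open>S\<close> cover the \<open>2 * m\<close>
    nonzero elements and have at most two elements each, hence \<open>S\<close> has at least
    \<open>m\<close>.\<close>
  have "UNIV - {0} = (\<Union>z\<in>S. {y. y\<^sup>2 = z}) - {0::'a}"
    by (auto simp: S_def)
  then have "card (UNIV - {0::'a}) \<le> card (\<Union>z\<in>S. {y. y\<^sup>2 = z})"
    by (metis Diff_subset card_mono finite)
  also have "\<dots> \<le> (\<Sum>z\<in>S. card {y. y\<^sup>2 = z})"
    by (rule card_UN_le) simp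
  also have "\<dots> \<le> (\<Sum>z\<in>S. 2)"
    by (intro sum_mono card_power_eq_le) simp
  finally have "m \<le> card S"
    using card by simp
  moreover have "card {y::'a. y ^ m = 1} \<le> m"
    using m by (rule card_power_eq_le)
  moreover have "S \<subseteq> {y. y ^ m = 1}"
  proof
    fix z assume "z \<in> S"
    then obtain y where y: "y \<noteq> 0" "z = y\<^sup>2" by (auto simp: S_def)
    have "z ^ m = y ^ (2 * m)"
      using y by (simp flip: power_mult)
    also have "\<dots> = 1"
      using subfield_power_card[of UNIV y] y card by (simp add: is_subfield_def)
    finally show "z \<in> {y. y ^ m = 1}" by simp
  qed
  ultimately have "S = {y. y ^ m = 1}"
    by (intro card_seteq) auto
  then show ?thesis using x by (force simp: S_def)
qed

text \<open>With \<open>q = 2 * j + 1\<close>, the Euler exponent of the large field is (q^2 - 1)/2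
  = (q - 1)(j + 1). It is a multiple of \<open>q - 1\<close>, which already sends every nonzero
  element of \<open>L\<close> to 1.\<close>

lemma subfield_square_root_exists:
  fixes L :: "'a::{field,finite} set"
  assumes "is_subfield L" "card L = q" "CARD('a) = q\<^sup>2" "odd q" "x \<in> L"
  shows "\<exists>y. y\<^sup>2 = x"
proof (cases "x = 0")
  case False
  obtain j where j: "q = 2 * j + 1" using \<open>odd q\<close> oddE by blast
  have "x ^ (q - 1) = 1"
    using subfield_power_card[of L x] assms False by simp
  then have "x ^ ((q - 1) * (j + 1)) = 1"
    by (simp only: power_mult power_one)
  then show ?thesis
    by (intro square_root_exists[of "(q - 1) * (j + 1)"])
       (auto simp: assms j power2_eq_square algebra_simps)
qed auto

section \<open>Polynomials over a subfield and their roots\<close>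

lemma subfield_of_nat: "is_subfield L \<Longrightarrow> of_nat m \<in> L"
  by (induction m) (auto simp: is_subfield_def)

lemma subfield_sum:
  assumes "is_subfield L" "\<And>i. i \<in> I \<Longrightarrow> f i \<in> L"
  shows "sum f I \<in> L"
  using assms(2) by (induction I rule: infinite_finite_induct) (use assms(1) in \<open>auto simp: is_subfield_def\<close>)

lemma subfield_power: "is_subfield L \<Longrightarrow> x \<in> L \<Longrightarrow> x ^ m \<in> L"
  by (induction m) (auto simp: is_subfield_def)

lemma subfield_mult: "is_subfield L \<Longrightarrow> x \<in> L \<Longrightarrow> y \<in> L \<Longrightarrow> x * y \<in> L"
  by (simp add: is_subfield_def)

lemma subfield_poly:
  assumes "is_subfield L" "poly_over L f" "x \<in> L"
  shows "poly f x \<in> L"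
  unfolding poly_altdef using assms
  by (intro subfield_sum subfield_mult subfield_power) (auto simp: poly_over_def)

lemma poly_over_pderiv:
  assumes "is_subfield L" "poly_over L f"
  shows "poly_over L (pderiv f)"
  using assms subfield_of_nat[OF assms(1)]
  by (metis coeff_pderiv poly_over_def subfield_mult)

text \<open>Roots are taken in the whole ambient type; this places them in \<open>L\<close>, where
  the linear factors live.\<close>

lemma splits_in_root:
  assumes "splits_in L f" "f \<noteq> 0" "poly f x = 0"
  shows "x \<in> L"
proof -
  obtain A where A: "set_mset A \<subseteq> L" "f = smult (lead_coeff f) (\<Prod>x\<in>#A. [:- x, 1:])"
    using assms(1) by (auto simp: splits_in_def)
  then have "poly (\<Prod>x\<in>#A. [:- x, 1:]) x = 0"
    using assms(2,3) by (metis leading_coeff_0_iff mult_eq_0_iff poly_smult)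
  then have "x \<in># A"
    by (auto simp: poly_prod_mset)
  then show ?thesis using A(1) by auto
qed

section \<open>Locator polynomials and Lagrange interpolation\<close>

lemma degree_locator: "degree (\<Prod>x\<in>A. [:- f x, 1 :: 'a::field:]) = card A"
  by (subst degree_prod_eq_sum_degree) auto

lemma coeff_locator_card: "coeff (\<Prod>x\<in>A. [:- f x, 1 :: 'a::field:]) (card A) = 1"
  using lead_coeff_prod[of "\<lambda>x. [:- f x, 1:]" A] by (simp add: degree_locator)

lemma poly_locator_eq_0_iff:
  "finite A \<Longrightarrow> poly (\<Prod>x\<in>A. [:- f x, 1 :: 'a::field:]) y = 0 \<longleftrightarrow> y \<in> f ` A"
  by (auto simp: poly_prod)

text \<open>In the product rule for \<open>[:- a, 1:]\<close> times the cofactor, the term that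
  keeps the linear factor vanishes at \<open>a\<close>. The resulting product of differences is
  nonzero, so division by the derivative is legitimate.\<close>

lemma poly_pderiv_locator:
  assumes "finite A" "a \<in> A"
  shows "poly (pderiv (\<Prod>x\<in>A. [:- x, 1 :: 'a::field:])) a = (\<Prod>x\<in>A - {a}. a - x)"
proof -
  have "(\<Prod>x\<in>A. [:- x, 1 :: 'a:]) = [:- a, 1:] * (\<Prod>x\<in>A - {a}. [:- x, 1:])"
    using assms by (rule prod.remove)
  then show ?thesis by (simp only: pderiv_mult) (simp add: pderiv_pCons poly_prod)
qed

text \<open>\<open>F\<close> equals its Lagrange interpolant \<open>G\<close> on \<open>A\<close>.
  Each \<open>l a\<close> is monic of degree \<open>card A - 1\<close>, so the coefficient of
  \<open>G\<close> in that degree is the sum of the interpolation weights.\<close>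

lemma sum_poly_div_pderiv:
  fixes A :: "'a::field set"
  assumes A: "finite A" "A \<noteq> {}" and deg: "degree F < card A"
  defines "g \<equiv> \<Prod>x\<in>A. [:- x, 1:]"
  shows "(\<Sum>x\<in>A. poly F x / poly (pderiv g) x) = coeff F (card A - 1)"
proof -
  define l where "l a = (\<Prod>x\<in>A - {a}. [:- x, 1:])" for a
  define G where "G = (\<Sum>a\<in>A. smult (poly F a / poly (pderiv g) a) (l a))"
  have card: "card (A - {a}) = card A - 1" if "a \<in> A" for a
    using that A by simp
  have pos: "card A > 0" using A by (simp add: card_gt_0_iff)
  have deg_G: "degree G \<le> card A - 1"
    unfolding G_def using A
    by (intro degree_sum_le) (auto simp: l_def degree_locator card intro: degree_smult_le[THEN order_trans])
  have "F = G"
  proof (rule poly_eqI_degree[of A])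
    fix y assume y: "y \<in> A"
    have l: "poly (l a) y = (if a = y then poly (pderiv g) y else 0)" if "a \<in> A" for a
      using that y A by (auto simp: l_def g_def poly_pderiv_locator poly_prod)
    have nz: "poly (pderiv g) y \<noteq> 0"
      using A y by (simp add: g_def poly_pderiv_locator)
    have "poly G y = (\<Sum>a\<in>A. if a = y then poly F y else 0)"
      unfolding G_def poly_sum using nz by (intro sum.cong) (auto simp: l)
    then show "poly F y = poly G y" using y A by simp
  qed (use deg deg_G pos in auto)
  have "coeff (l a) (card A - 1) = 1" if "a \<in> A" for a
    unfolding l_def using coeff_locator_card[of "\<lambda>x. x" "A - {a}"] card[OF that] by simp
  then have "coeff G (card A - 1) = (\<Sum>x\<in>A. poly F x / poly (pderiv g) x)"
    unfolding G_def coeff_sum by (intro sum.cong) auto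
  then show ?thesis using \<open>F = G\<close> by simp
qed

section \<open>Dimension of the span of an indexed family\<close>

text \<open>Bridges from independence of a family indexed by numbers to the library's notion for
  sets; this requires that \<open>w\<close> has no repetitions, which independence itself
  supplies.\<close>

lemma independent_family:
  fixes w :: "nat \<Rightarrow> 'a::field ^ 'n"
  assumes ind: "\<And>u. (\<Sum>i<k. u i *s w i) = 0 \<Longrightarrow> \<forall>i<k. u i = 0"
  shows "vec.subspace {(\<Sum>i<k. u i *s w i) | u. True}"
    and "vec.dim {(\<Sum>i<k. u i *s w i) | u. True} = k"
proof -
  have inj: "inj_on w {..<k}"
  proof (rule inj_onI, rule ccontr)
    fix i j assume ij: "i \<in> {..<k}" "j \<in> {..<k}" "w i = w j" "i \<noteq> j"
    \<comment> \<open>The relation \<open>w i - w j = 0\<close>, written as a coefficient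
      vector.\<close>
    define u :: "nat \<Rightarrow> 'a"
      where "u l = (if l = i then 1 else 0) - (if l = j then 1 else 0)" for l
    have "(\<Sum>l<k. u l *s w l) =
        (\<Sum>l<k. if l = i then w l else 0) - (\<Sum>l<k. if l = j then w l else 0)"
      unfolding sum_subtractf[symmetric] by (intro sum.cong) (auto simp: u_def vec.scale_left_diff_distrib)
    also have "\<dots> = 0" using ij by simp
    finally have "\<forall>l<k. u l = 0" by (rule ind)
    then show False using ij by (auto simp: u_def)
  qed
  have span: "{(\<Sum>i<k. u i *s w i) | u. True} = vec.span (w ` {..<k})"
  proof -
    have "(\<Sum>i<k. u i *s w i) \<in> vec.span (w ` {..<k})" for u
      by (intro vec.span_sum vec.span_scale vec.span_base) auto
    moreover have "\<exists>u. y = (\<Sum>i<k. u i *s w i)" if "y \<in> vec.span (w ` {..<k})" for y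
      using that inj by (auto simp: vec.span_finite sum.reindex)
    ultimately show ?thesis by blast
  qed
  have indep: "vec.independent (w ` {..<k})"
  proof (rule vec.independent_if_scalars_zero)
    fix f x assume "(\<Sum>x\<in>w ` {..<k}. f x *s x) = 0" "x \<in> w ` {..<k}"
    then show "f x = 0"
      using ind[of "f \<circ> w"] inj by (auto simp: sum.reindex)
  qed simp
  show "vec.subspace {(\<Sum>i<k. u i *s w i) | u. True}"
    unfolding span by (rule vec.subspace_span)
  show "vec.dim {(\<Sum>i<k. u i *s w i) | u. True} = k"
    unfolding span using indep inj by (simp add: vec.dim_eq_card_independent card_image)
qed

section \<open>Reduction modulo a locator polynomial\<close>

text \<open>The sum sees only values on \<open>A\<close>, so \<open>F\<close> may be replaced by its
  remainder modulo \<open>g\<close>. The degree bound makes the quotient linear, and interpolation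
  then reads off one coefficient of the remainder.\<close>

lemma sum_poly_div_pderiv_reduce:
  fixes A :: "'a::field set" and F :: "'a poly"
  assumes A: "finite A" "2 \<le> card A" and deg: "degree F \<le> card A + 1"
  defines "g \<equiv> \<Prod>x\<in>A. [:- x, 1:]"
  defines "a \<equiv> coeff g (card A - 1)" and "b \<equiv> coeff g (card A - 2)"
  shows "(\<Sum>x\<in>A. poly F x / poly (pderiv g) x) =
    coeff F (card A - 1) - a * coeff F (card A) + (a\<^sup>2 - b) * coeff F (card A + 1)"
proof -
  define m where "m = card A - 2"
  then have m: "card A = Suc (Suc m)"
    using A(2) by simp
  have g: "degree g = Suc (Suc m)" "coeff g (Suc (Suc m)) = 1" "coeff g (Suc m) = a" "coeff g m = b"
    using coeff_locator_card[of "\<lambda>x. x" A]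
    by (auto simp: g_def degree_locator m a_def b_def)
  \<comment> \<open>\<open>u\<close> and \<open>w\<close> are the coefficients of the quotient
    \<open>[:w, u:]\<close>, chosen so that the two coefficients of \<open>R\<close> in degrees
    \<open>card A + 1\<close> and \<open>card A\<close> cancel.\<close>
  define u where "u = coeff F (card A + 1)"
  define w where "w = coeff F (card A) - a * u"
  define R where "R = F - g * [:w, u:]"
  have coeff_R: "coeff R (Suc i) = coeff F (Suc i) - (w * coeff g (Suc i) + u * coeff g i)" for i
    by (simp add: R_def)
  have "degree R \<le> Suc m"
  proof (rule degree_le, intro allI impI)
    fix i assume "Suc m < i"
    then obtain j where j: "i = Suc j" "Suc m \<le> j" by (metis Suc_le_D Suc_le_mono less_eq_Suc_le)
    consider "j = Suc m" | "j = Suc (Suc m)" | "j > Suc (Suc m)" using j by linarith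
    then show "coeff R i = 0"
    proof cases
      case 1
      then show ?thesis by (simp add: j(1) coeff_R g w_def u_def m)
    next
      case 2
      then show ?thesis by (simp add: j(1) coeff_R g coeff_eq_0 w_def u_def m)
    next
      case 3
      then show ?thesis using deg by (simp add: j(1) coeff_R g coeff_eq_0 m)
    qed
  qed
  then have "(\<Sum>x\<in>A. poly R x / poly (pderiv g) x) = coeff R (Suc m)"
    using sum_poly_div_pderiv[OF A(1), of R] A(2) m unfolding g_def by force
  moreover have "poly R x = poly F x" if "x \<in> A" for x
    using that poly_locator_eq_0_iff[OF A(1), of "\<lambda>x. x" x] by (simp add: R_def g_def)
  ultimately show ?thesis
    by (simp add: coeff_R g m w_def u_def algebra_simps power2_eq_square)
qed

text \<open>The remainder modulo the product would otherwise be a nonzero polynomial of degree below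
  \<open>card I\<close> with \<open>card I\<close> distinct roots.\<close>

lemma locator_dvd:
  fixes f :: "'b \<Rightarrow> 'a::field"
  assumes "finite I" "inj_on f I" "\<And>i. i \<in> I \<Longrightarrow> poly F (f i) = 0"
  shows "(\<Prod>i\<in>I. [:- f i, 1:]) dvd F"
proof -
  let ?P = "\<Prod>i\<in>I. [:- f i, 1:]"
  have "?P \<noteq> 0" using assms(1) by simp
  have "F mod ?P = 0"
  proof (rule ccontr)
    assume nz: "F mod ?P \<noteq> 0"
    then have "degree (F mod ?P) < card I"
      using degree_mod_less[OF \<open>?P \<noteq> 0\<close>, of F] by (simp add: degree_locator)
    moreover have "poly (F mod ?P) (f i) = 0" if "i \<in> I" for i
    proof -
      have "poly ?P (f i) = 0"
        using that assms(1) by (subst poly_locator_eq_0_iff) auto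
      then show ?thesis
        using assms(3)[OF that] poly_mod[of ?P "f i" F] by simp
    qed
    ultimately have "F mod ?P = 0"
      using assms(2) by (intro poly_eqI_degree[of "f ` I"]) (auto simp: card_image)
    then show False using nz by contradiction
  qed
  then show ?thesis by (simp add: dvd_eq_mod_eq_0)
qed

section \<open>The space of polynomials with two twists\<close>

text \<open>For \<open>k > 0\<close> this is the space of the theorem's \<open>S\<^sub>1\<close>,
  cut out by linear conditions on coefficients instead of parametrised; membership and closure under
  differences become coefficient checks.\<close>

definition two_twist_polys :: "nat \<Rightarrow> 'a \<Rightarrow> 'a \<Rightarrow> 'a::field poly set" where
  "two_twist_polys k \<eta>\<^sub>1 \<eta>\<^sub>2 =
     {F. degree F \<le> k + 1 \<and> coeff F k = \<eta>\<^sub>1 * coeff F (k - 1) \<and>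
         coeff F (k + 1) = \<eta>\<^sub>2 * coeff F (k - 1)}"

lemma coeff_two_twist:
  "coeff ((\<Sum>i<k. monom (f i) i) + smult (f (k - 1)) (monom \<eta>\<^sub>1 k + monom \<eta>\<^sub>2 (k + 1))) i =
    (if i < k then f i else if i = k then f (k - 1) * \<eta>\<^sub>1
     else if i = k + 1 then f (k - 1) * \<eta>\<^sub>2 else (0 :: 'a::field))"
  by (auto simp: coeff_sum)

lemma two_twist_polys_eq:
  assumes "k > 0"
  shows "two_twist_polys k \<eta>\<^sub>1 \<eta>\<^sub>2 =
    {(\<Sum>i<k. monom (f i) i) + smult (f (k - 1)) (monom \<eta>\<^sub>1 k + monom \<eta>\<^sub>2 (k + 1)) | f. True}"
    (is "_ = ?S")
proof (intro equalityI subsetI)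
  fix F assume F: "F \<in> two_twist_polys k \<eta>\<^sub>1 \<eta>\<^sub>2"
  have "F = (\<Sum>i<k. monom (coeff F i) i) +
      smult (coeff F (k - 1)) (monom \<eta>\<^sub>1 k + monom \<eta>\<^sub>2 (k + 1))"
    using F by (intro poly_eqI, subst coeff_two_twist) (auto simp: two_twist_polys_def mult.commute intro!: coeff_eq_0)
  then show "F \<in> ?S" by blast
next
  fix F assume "F \<in> ?S"
  then obtain f where F: "F = (\<Sum>i<k. monom (f i) i) +
      smult (f (k - 1)) (monom \<eta>\<^sub>1 k + monom \<eta>\<^sub>2 (k + 1))" by auto
  have "coeff F i = 0" if "k + 1 < i" for i
    using that unfolding F coeff_two_twist by auto
  then have "degree F \<le> k + 1" by (intro degree_le) auto
  moreover have "coeff F k = \<eta>\<^sub>1 * coeff F (k - 1)" "coeff F (k + 1) = \<eta>\<^sub>2 * coeff F (k - 1)"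
    using assms unfolding F coeff_two_twist by auto
  ultimately show "F \<in> two_twist_polys k \<eta>\<^sub>1 \<eta>\<^sub>2" by (simp add: two_twist_polys_def)
qed

text \<open>If \<open>F = (\<Prod>i\<in>I. x - \<alpha>\<^sub>i) (u x + w)\<close>, comparing the coefficients of \<open>x\<^bsup>k+1\<^esup>\<close>,
  \<open>x\<^bsup>k\<^esup>\<close> and \<open>x\<^bsup>k-1\<^esup>\<close> and eliminating \<open>u\<close> and \<open>w\<close> gives exactly the excluded relation.\<close>

lemma two_twist_polys_roots:
  fixes \<alpha> :: "'a::field ^ 'n"
  assumes F: "F \<in> two_twist_polys k \<eta>\<^sub>1 \<eta>\<^sub>2" and k: "k > 0" and \<alpha>: "inj (($) \<alpha>)"
    and I: "card I = k" "\<And>i. i \<in> I \<Longrightarrow> poly F (\<alpha> $ i) = 0"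
    and ne: "\<eta>\<^sub>1 * locator_coeff \<alpha> k I 1 +
           \<eta>\<^sub>2 * (locator_coeff \<alpha> k I 2 - (locator_coeff \<alpha> k I 1)\<^sup>2) \<noteq> 1"
  shows "F = 0"
proof -
  define P where "P = (\<Prod>i\<in>I. [:- (\<alpha> $ i), 1:])"
  obtain m where m: "k = Suc m" using k gr0_implies_Suc by blast
  have P: "degree P = Suc m" "coeff P (Suc m) = 1"
    using coeff_locator_card[of "($) \<alpha>" I] I(1) m by (auto simp: P_def degree_locator)
  have "P dvd F"
    unfolding P_def using I \<alpha> k by (intro locator_dvd) (auto intro: inj_on_subset card_ge_0_finite)
  then obtain Q where Q: "F = P * Q" by blast
  have "degree Q \<le> 1"
  proof (cases "Q = 0")
    case False
    then have "degree F = Suc m + degree Q"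
      unfolding Q using P by (subst degree_mult_eq) auto
    then show ?thesis using F m by (simp add: two_twist_polys_def)
  qed simp
  then obtain w u where wu: "Q = [:w, u:]"
    by (metis One_nat_def degree1_coeffs degree_eq_zeroE le_Suc_eq le_zero_eq pCons_0_0)
  define c1 where "c1 = locator_coeff \<alpha> k I 1"
  define c2 where "c2 = locator_coeff \<alpha> k I 2"
  \<comment> \<open>For \<open>k = 1\<close> there is no third coefficient from the top, and
    \<open>c2\<close> is 0 by the convention in \<open>locator_coeff\<close>.\<close>
  have c: "c1 = coeff P m" "c2 = (case m of 0 \<Rightarrow> 0 | Suc l \<Rightarrow> coeff P l)"
    by (auto simp: c1_def c2_def locator_coeff_def m P_def split: nat.split)
  have F_eq: "F = smult w P + pCons 0 (smult u P)"
    by (simp add: Q wu)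
  define y where "y = coeff F m"
  have 1: "u = \<eta>\<^sub>2 * y" "w + u * c1 = \<eta>\<^sub>1 * y"
    using F by (auto simp: two_twist_polys_def m y_def F_eq P c coeff_eq_0)
  have 2: "y = w * c1 + u * c2"
    by (simp add: y_def F_eq c coeff_pCons split: nat.split)
  have "w = \<eta>\<^sub>1 * y - u * c1" using 1(2) by algebra
  then have "y * (\<eta>\<^sub>1 * c1 + \<eta>\<^sub>2 * (c2 - c1\<^sup>2) - 1) = 0"
    using 1 2 by algebra
  then have "y = 0" using ne by (simp add: c1_def c2_def)
  then show ?thesis using 1 by (simp add: F_eq)
qed

text \<open>Supplies a word of minimum weight: a quadratic cofactor of the locator of
  \<open>J\<close> has three free coefficients, enough to prescribe the coefficients in degrees
  \<open>k - 1\<close>, \<open>k\<close> and \<open>k + 1\<close> as 1,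
  \<open>\<eta>\<^sub>1\<close> and \<open>\<eta>\<^sub>2\<close>.\<close>

lemma two_twist_polys_attained:
  fixes f :: "'b \<Rightarrow> 'a::field"
  assumes k: "k > 0" and J: "finite J" "card J = k - 1"
  shows "\<exists>F\<in>two_twist_polys k \<eta>\<^sub>1 \<eta>\<^sub>2. F \<noteq> 0 \<and> (\<forall>i\<in>J. poly F (f i) = 0)"
proof -
  define P where "P = (\<Prod>i\<in>J. [:- f i, 1:])"
  obtain m where m: "k = Suc m" using k gr0_implies_Suc by blast
  have P: "degree P = m" "coeff P m = 1"
    using coeff_locator_card[of f J] J(2) m by (auto simp: P_def degree_locator)
  \<comment> \<open>The second and third coefficients of \<open>P\<close> from the top. Shifting by
    \<open>pCons 0\<close> instead of subtracting from \<open>m\<close> yields 0 when they do not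
    exist.\<close>
  define d1 where "d1 = coeff (pCons 0 P) m"
  define d2 where "d2 = coeff (pCons 0 (pCons 0 P)) m"
  \<comment> \<open>Solves the triangular system
    \<open>w + \<eta>\<^sub>2 * d1 = \<eta>\<^sub>1\<close> and
    \<open>z + w * d1 + \<eta>\<^sub>2 * d2 = 1\<close>.\<close>
  define w where "w = \<eta>\<^sub>1 - \<eta>\<^sub>2 * d1"
  define z where "z = 1 - w * d1 - \<eta>\<^sub>2 * d2"
  define F where "F = P * [:z, w, \<eta>\<^sub>2:]"
  have F_eq: "F = smult z P + smult w (pCons 0 P) + smult \<eta>\<^sub>2 (pCons 0 (pCons 0 P))"
    by (simp add: F_def algebra_simps)
  have c: "coeff F m = 1" "coeff F (Suc m) = \<eta>\<^sub>1" "coeff F (Suc (Suc m)) = \<eta>\<^sub>2"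
    using P by (auto simp: F_eq z_def w_def d1_def d2_def coeff_eq_0 simp del: smult_pCons)
  have "degree F \<le> m + 2"
    unfolding F_def using P
    by (intro order_trans[OF degree_mult_le]) (auto simp: degree_pCons_eq_if)
  then have "F \<in> two_twist_polys k \<eta>\<^sub>1 \<eta>\<^sub>2"
    by (simp add: two_twist_polys_def m c)
  moreover have "F \<noteq> 0" using c(1) by auto
  moreover have "poly F (f i) = 0" if "i \<in> J" for i
  proof -
    have "poly P (f i) = 0" using that J(1) by (simp add: P_def poly_locator_eq_0_iff)
    then show ?thesis by (simp add: F_def)
  qed
  ultimately show ?thesis by blast
qed

text \<open>Both factors have degree at most \<open>k + 1\<close>, so from degree
  \<open>2 * k\<close> on only coefficients of index at least \<open>k - 1\<close> meet, and each of
  these is a multiple of the one at \<open>k - 1\<close>.\<close>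

lemma coeff_mult_two_twist:
  fixes F G :: "'a::field poly"
  assumes "k > 0" and F: "F \<in> two_twist_polys k \<eta>\<^sub>1 \<eta>\<^sub>2" and G: "G \<in> two_twist_polys k \<eta>\<^sub>1 \<eta>\<^sub>2"
  defines "x \<equiv> coeff F (k - 1) * coeff G (k - 1)"
  shows "coeff (F * G) (2 * k) = (\<eta>\<^sub>1\<^sup>2 + 2 * \<eta>\<^sub>2) * x"
    and "coeff (F * G) (2 * k + 1) = 2 * \<eta>\<^sub>1 * \<eta>\<^sub>2 * x"
    and "coeff (F * G) (2 * k + 2) = \<eta>\<^sub>2\<^sup>2 * x"
proof -
  obtain m where m: "k = Suc m" using \<open>k > 0\<close> gr0_implies_Suc by blast
  have FG: "coeff F i * coeff G j = 0" if "\<not> (i \<le> m + 2 \<and> j \<le> m + 2)" for i j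
    using that F G coeff_eq_0[of F i] coeff_eq_0[of G j] by (auto simp: two_twist_polys_def m)
  have c: "coeff F (Suc m) = \<eta>\<^sub>1 * coeff F m" "coeff F (Suc (Suc m)) = \<eta>\<^sub>2 * coeff F m"
    "coeff G (Suc m) = \<eta>\<^sub>1 * coeff G m" "coeff G (Suc (Suc m)) = \<eta>\<^sub>2 * coeff G m"
    using F G by (auto simp: two_twist_polys_def m)
  have "coeff (F * G) (2 * k) = (\<Sum>i\<in>{m, Suc m, Suc (Suc m)}. coeff F i * coeff G (2 * k - i))"
    unfolding coeff_mult by (intro sum.mono_neutral_right ballI FG) (auto simp: m)
  then show "coeff (F * G) (2 * k) = (\<eta>\<^sub>1\<^sup>2 + 2 * \<eta>\<^sub>2) * x"
    by (simp add: m c x_def algebra_simps power2_eq_square)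
  have "coeff (F * G) (2 * k + 1) = (\<Sum>i\<in>{Suc m, Suc (Suc m)}. coeff F i * coeff G (2 * k + 1 - i))"
    unfolding coeff_mult by (intro sum.mono_neutral_right ballI FG) (auto simp: m)
  then show "coeff (F * G) (2 * k + 1) = 2 * \<eta>\<^sub>1 * \<eta>\<^sub>2 * x"
    by (simp add: m c x_def algebra_simps)
  have "coeff (F * G) (2 * k + 2) = (\<Sum>i\<in>{Suc (Suc m)}. coeff F i * coeff G (2 * k + 2 - i))"
    unfolding coeff_mult by (intro sum.mono_neutral_right ballI FG) (auto simp: m)
  then show "coeff (F * G) (2 * k + 2) = \<eta>\<^sub>2\<^sup>2 * x"
    by (simp add: m c x_def algebra_simps power2_eq_square)
qed

section \<open>Evaluation codes: distance, dimension, TGRS form and self-orthogonality\<close>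

lemma big_range_inj:
  fixes \<alpha> :: "'a ^ 'n"
  assumes "inj (($) \<alpha>)"
  shows "(\<Prod>x\<in>range (($) \<alpha>). f x) = (\<Prod>i\<in>UNIV. f (\<alpha> $ i))"
    and "(\<Sum>x\<in>range (($) \<alpha>). h x) = (\<Sum>i\<in>UNIV. h (\<alpha> $ i))"
    and "card (range (($) \<alpha>)) = CARD('n)"
  using assms by (simp_all add: prod.reindex sum.reindex card_image)

lemma ev_nth_eq_iff:
  fixes \<alpha> v :: "'a::field ^ 'n"
  assumes "\<forall>i. v $ i \<noteq> 0"
  shows "ev \<alpha> v F $ i = ev \<alpha> v G $ i \<longleftrightarrow> poly (F - G) (\<alpha> $ i) = 0"
  using assms by (simp add: ev_def)

lemma ev_sum_smult:
  "ev \<alpha> v (\<Sum>i\<in>I. smult (f i) (e i)) = (\<Sum>i\<in>I. f i *s ev \<alpha> v (e i))"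
  by (simp add: vec_eq_iff ev_def poly_sum sum_distrib_left mult.left_commute)

lemma hamming_dist_ev:
  fixes \<alpha> v :: "'a::field ^ 'n"
  assumes "\<forall>i. v $ i \<noteq> 0"
  shows "hamming_dist (ev \<alpha> v F) (ev \<alpha> v G) = CARD('n) - card {i. poly (F - G) (\<alpha> $ i) = 0}"
proof -
  have "{i. ev \<alpha> v F $ i \<noteq> ev \<alpha> v G $ i} = UNIV - {i. poly (F - G) (\<alpha> $ i) = 0}"
    using ev_nth_eq_iff[OF assms] by blast
  then show ?thesis unfolding hamming_dist_def by (simp add: card_Diff_subset)
qed

lemma two_twist_polys_diff:
  "F \<in> two_twist_polys k \<eta>\<^sub>1 \<eta>\<^sub>2 \<Longrightarrow> G \<in> two_twist_polys k \<eta>\<^sub>1 \<eta>\<^sub>2 \<Longrightarrow> F - G \<in> two_twist_polys k \<eta>\<^sub>1 \<eta>\<^sub>2"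
  by (auto simp: two_twist_polys_def degree_diff_le algebra_simps)

text \<open>A nonzero difference of two polynomials of the space has fewer than \<open>k\<close>
  roots among the evaluation points, which bounds the distance from below; a polynomial with
  \<open>k - 1\<close> prescribed roots attains the bound. The same bound makes evaluation injective
  and so gives the dimension.\<close>

lemma two_twist_is_code:
  fixes \<alpha> v :: "'a::field ^ 'n"
  assumes k: "k > 0" "k \<le> CARD('n)" and \<alpha>: "inj (($) \<alpha>)" and v: "\<forall>i. v $ i \<noteq> 0"
    and ne: "\<And>I :: 'n set. card I = k \<Longrightarrow>
           \<eta>\<^sub>1 * locator_coeff \<alpha> k I 1 +
           \<eta>\<^sub>2 * (locator_coeff \<alpha> k I 2 - (locator_coeff \<alpha> k I 1)\<^sup>2) \<noteq> 1"
  shows "is_code CARD('n) k (CARD('n) - k + 1) (ev \<alpha> v ` two_twist_polys k \<eta>\<^sub>1 \<eta>\<^sub>2)"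
proof -
  let ?T = "two_twist_polys k \<eta>\<^sub>1 \<eta>\<^sub>2"
  have roots: "card {i. poly F (\<alpha> $ i) = 0} < k" if F: "F \<in> ?T" "F \<noteq> 0" for F
  proof (rule ccontr)
    assume "\<not> card {i. poly F (\<alpha> $ i) = 0} < k"
    then obtain I where I: "I \<subseteq> {i. poly F (\<alpha> $ i) = 0}" "card I = k"
      by (metis not_less obtain_subset_with_card_n)
    then have "F = 0"
      using two_twist_polys_roots[OF F(1) k(1) \<alpha>, of I] ne[of I] by blast
    then show False using F(2) by contradiction
  qed
  have dist: "CARD('n) - k + 1 \<le> hamming_dist (ev \<alpha> v F) (ev \<alpha> v G)"
    if "F \<in> ?T" "G \<in> ?T" "F \<noteq> G" for F G
    using roots[of "F - G"] that two_twist_polys_diff[OF that(1,2)] k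
    by (simp add: hamming_dist_ev[OF v] del: poly_diff)
  have zero: "0 \<in> ?T" by (simp add: two_twist_polys_def)
  have min_dist: "min_dist (ev \<alpha> v ` ?T) = CARD('n) - k + 1"
    unfolding min_dist_def
  proof (rule cInf_eq_minimum)
    obtain J :: "'n set" where J: "card J = k - 1"
      using obtain_subset_with_card_n[of "k - 1" "UNIV :: 'n set"] k(2) by (metis diff_le_self order_trans)
    obtain F where F: "F \<in> ?T" "F \<noteq> 0" "\<forall>i\<in>J. poly F (\<alpha> $ i) = 0"
      using two_twist_polys_attained[OF k(1) _ J, of \<eta>\<^sub>1 \<eta>\<^sub>2 "($) \<alpha>"] by auto
    have "k - 1 \<le> card {i. poly F (\<alpha> $ i) = 0}"
      unfolding J[symmetric] using F(3) by (intro card_mono) auto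
    then have "hamming_dist (ev \<alpha> v F) (ev \<alpha> v 0) \<le> CARD('n) - k + 1"
      using k by (simp add: hamming_dist_ev[OF v])
    then have "hamming_dist (ev \<alpha> v F) (ev \<alpha> v 0) = CARD('n) - k + 1"
      using dist[OF F(1) zero F(2)] by simp
    \<comment> \<open>The infimum ranges over distinct words only; the positive distance ensures
      this.\<close>
    moreover from this have "ev \<alpha> v F \<noteq> ev \<alpha> v 0"
      by (auto simp: hamming_dist_def)
    ultimately show "CARD('n) - k + 1 \<in>
        {hamming_dist x y |x y. x \<in> ev \<alpha> v ` ?T \<and> y \<in> ev \<alpha> v ` ?T \<and> x \<noteq> y}"
      using F(1) zero by (metis (mono_tags, lifting) imageI mem_Collect_eq)
  next
    fix d assume "d \<in> {hamming_dist x y |x y. x \<in> ev \<alpha> v ` ?T \<and> y \<in> ev \<alpha> v ` ?T \<and> x \<noteq> y}"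
    then show "CARD('n) - k + 1 \<le> d" using dist by auto
  qed
  \<comment> \<open>A basis of the space: the monomials below degree \<open>k\<close>, with the
    whole twist attached to the last one.\<close>
  define e where "e i = monom 1 i + (if i = k - 1 then monom \<eta>\<^sub>1 k + monom \<eta>\<^sub>2 (k + 1) else 0)" for i
  have e: "(\<Sum>i<k. smult (f i) (e i)) =
      (\<Sum>i<k. monom (f i) i) + smult (f (k - 1)) (monom \<eta>\<^sub>1 k + monom \<eta>\<^sub>2 (k + 1))" for f
  proof -
    have "(\<Sum>i<k. smult (f i) (e i)) = (\<Sum>i<k. monom (f i) i) +
        (\<Sum>i<k. if i = k - 1 then smult (f i) (monom \<eta>\<^sub>1 k + monom \<eta>\<^sub>2 (k + 1)) else 0)"
      unfolding sum.distrib[symmetric] by (intro sum.cong) (auto simp: e_def smult_monom smult_add_right)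
    then show ?thesis using k(1) by simp
  qed
  have T: "?T = {(\<Sum>i<k. smult (f i) (e i)) | f. True}"
    unfolding two_twist_polys_eq[OF k(1)] e ..
  have code: "ev \<alpha> v ` ?T = {(\<Sum>i<k. f i *s ev \<alpha> v (e i)) | f. True}"
    unfolding T ev_sum_smult[symmetric] by blast
  have ind: "\<forall>i<k. u i = 0" if "(\<Sum>i<k. u i *s ev \<alpha> v (e i)) = 0" for u
  proof -
    define F where "F = (\<Sum>i<k. smult (u i) (e i))"
    \<comment> \<open>Distinct polynomials give words at distance at least
      \<open>CARD('n) - k + 1 > 0\<close>, so distance 0 forces \<open>F = 0\<close>.\<close>
    have "hamming_dist (ev \<alpha> v F) (ev \<alpha> v 0) = 0"
      using that by (simp add: F_def ev_sum_smult hamming_dist_def ev_def[of _ _ 0])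
    moreover have "F \<in> ?T" unfolding T F_def by blast
    ultimately have "F = 0" using dist[of F 0] zero by auto
    show ?thesis
    proof (intro allI impI)
      fix i assume "i < k"
      then have "coeff F i = u i"
        unfolding F_def e coeff_two_twist by simp
      then show "u i = 0" using \<open>F = 0\<close> by simp
    qed
  qed
  show ?thesis
    unfolding is_code_def using min_dist independent_family[where k = k and w = "\<lambda>i. ev \<alpha> v (e i)", OF ind] code by simp
qed

lemma two_twist_is_TGRS:
  fixes \<alpha> v :: "'a::field ^ 'n"
  assumes k: "k > 0" "k + 2 \<le> CARD('n)" and \<alpha>: "inj (($) \<alpha>)" and v: "\<forall>i. v $ i \<noteq> 0"
  shows "is_TGRS k (ev \<alpha> v ` two_twist_polys k \<eta>\<^sub>1 \<eta>\<^sub>2)"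
proof -
  \<comment> \<open>Row \<open>i\<close> of the twist matrix belongs to the coefficient
    \<open>f (i - 1)\<close>, so the twist of \<open>f (k - 1)\<close> sits in row \<open>k\<close>.
    Columns 1 and 2 stand for degrees \<open>k\<close> and \<open>k + 1\<close>; they exist because
    \<open>k + 2 \<le> CARD('n)\<close>.\<close>
  define \<eta> where "\<eta> i j = (if i = k then if j = 1 then \<eta>\<^sub>1 else if j = 2 then \<eta>\<^sub>2 else 0 else 0)"
    for i j :: nat
  have inner: "(\<Sum>j=1..CARD('n)-k. monom (\<eta> (i + 1) j) (k - 1 + j)) =
      (if i = k - 1 then monom \<eta>\<^sub>1 k + monom \<eta>\<^sub>2 (k + 1) else 0)" if "i < k" for i
  proof (cases "i = k - 1")
    case True
    have "(\<Sum>j=1..CARD('n)-k. monom (\<eta> (i + 1) j) (k - 1 + j)) =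
        (\<Sum>j\<in>{1, 2}. monom (\<eta> (i + 1) j) (k - 1 + j))"
      using k True by (intro sum.mono_neutral_right) (auto simp: \<eta>_def)
    then show ?thesis using True k by (simp add: \<eta>_def)
  qed (use that in \<open>auto simp: \<eta>_def intro!: sum.neutral\<close>)
  have "(\<Sum>i<k. smult (f i) (\<Sum>j=1..CARD('n)-k. monom (\<eta> (i + 1) j) (k - 1 + j))) =
      smult (f (k - 1)) (monom \<eta>\<^sub>1 k + monom \<eta>\<^sub>2 (k + 1))" for f
  proof -
    have "(\<Sum>i<k. smult (f i) (\<Sum>j=1..CARD('n)-k. monom (\<eta> (i + 1) j) (k - 1 + j))) =
        (\<Sum>i<k. if i = k - 1 then smult (f i) (monom \<eta>\<^sub>1 k + monom \<eta>\<^sub>2 (k + 1)) else 0)"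
      by (intro sum.cong refl, subst inner) auto
    then show ?thesis using k by simp
  qed
  then have "two_twist_polys k \<eta>\<^sub>1 \<eta>\<^sub>2 = twisted_polys CARD('n) k \<eta>"
    unfolding two_twist_polys_eq[OF k(1)] twisted_polys_def by simp
  then show ?thesis
    unfolding is_TGRS_def using k \<alpha> v by auto
qed

lemma two_twist_self_orthogonal:
  fixes \<alpha> v :: "'a::field ^ 'n"
  assumes k: "k > 0" "CARD('n) = 2 * k + 1" and \<alpha>: "inj (($) \<alpha>)"
  defines "g \<equiv> \<Prod>i\<in>UNIV. [:- (\<alpha> $ i), 1:]"
  assumes v: "\<And>i. (v $ i)\<^sup>2 = inverse (poly (pderiv g) (\<alpha> $ i))"
    and a: "coeff g (2 * k) = a" and b: "coeff g (2 * k - 1) = b" "b \<noteq> 0"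
  shows "self_orthogonal (ev \<alpha> v ` two_twist_polys k (2 * a * inverse b) (2 * inverse b))"
proof -
  let ?T = "two_twist_polys k (2 * a * inverse b) (2 * inverse b)"
  let ?A = "range (($) \<alpha>)"
  have g: "g = (\<Prod>x\<in>?A. [:- x, 1:])"
    by (simp add: g_def big_range_inj[OF \<alpha>])
  have card: "card ?A = 2 * k + 1"
    using big_range_inj(3)[OF \<alpha>] k by simp
  have "scalar_product (ev \<alpha> v F) (ev \<alpha> v G) = 0" if F: "F \<in> ?T" and G: "G \<in> ?T" for F G
  proof -
    define y where "y = coeff F (k - 1) * coeff G (k - 1)"
    have "v $ i * poly F (\<alpha> $ i) * (v $ i * poly G (\<alpha> $ i)) =
        poly (F * G) (\<alpha> $ i) / poly (pderiv g) (\<alpha> $ i)" for i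
    proof -
      have "v $ i * poly F (\<alpha> $ i) * (v $ i * poly G (\<alpha> $ i)) = (v $ i)\<^sup>2 * poly (F * G) (\<alpha> $ i)"
        by (simp add: power2_eq_square)
      then show ?thesis by (simp add: v divide_inverse mult.commute)
    qed
    then have "scalar_product (ev \<alpha> v F) (ev \<alpha> v G) =
        (\<Sum>x\<in>?A. poly (F * G) x / poly (pderiv g) x)"
      unfolding scalar_product_def ev_def big_range_inj[OF \<alpha>] by simp
    also have "\<dots> = coeff (F * G) (2 * k) - a * coeff (F * G) (2 * k + 1) +
        (a\<^sup>2 - b) * coeff (F * G) (2 * k + 2)"
    proof -
      have "degree (F * G) \<le> (k + 1) + (k + 1)"
        using F G by (intro order_trans[OF degree_mult_le] add_mono) (auto simp: two_twist_polys_def)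
      then have "degree (F * G) \<le> card ?A + 1" using card by simp
      then show ?thesis
        using sum_poly_div_pderiv_reduce[of ?A "F * G", folded g] k a b(1) by (simp add: card)
    qed
    also have "\<dots> = ((2 * a * inverse b)\<^sup>2 + 2 * (2 * inverse b)) * y
        - a * (2 * (2 * a * inverse b) * (2 * inverse b) * y) + (a\<^sup>2 - b) * ((2 * inverse b)\<^sup>2 * y)"
      unfolding y_def using coeff_mult_two_twist[OF k(1) F G] by simp
    \<comment> \<open>The multiples of a^2/b^2 are 4 - 8 + 4, and those of 1/b are 4 - 4.\<close>
    also have "\<dots> = 0"
      using b(2) by (simp add: field_simps power2_eq_square)
    finally show ?thesis .
  qed
  then show ?thesis by (auto simp: self_orthogonal_def dual_code_def)
qed

section \<open>The code attached to the roots of \<open>g\<close>\<close>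

theorem proposition31:
  fixes p s h t r q n k :: nat
    and K L :: "'F::{field,finite} set"
    and a b c \<eta>\<^sub>1 \<eta>\<^sub>2 :: 'F
    and g :: "'F poly"
    and \<alpha> :: "'F ^ 'n"
    and S\<^sub>1 :: "'F poly set"
  assumes "prime p" and "odd p"
    and "s > 0" and "h > 0" and "t > 0" and "r > 0"
    and "odd r" and "t dvd h" and "s \<le> h" and "coprime r p"
    and "q = p ^ h"
    and "CARD('F) = q ^ 2"
    and "is_subfield K" and "card K = p ^ t"
    and "is_subfield L" and "card L = q"
    and "n = r * p ^ s" and "CARD('n) = n"
    and "a \<in> K" and "b \<in> K" and "c \<in> K"
    and "a \<noteq> 0" and "b \<noteq> 0" and "c \<noteq> 0"
    and "g = monom 1 n + monom a (n - 1) + monom b (n - 2) + [:c:]"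
    and "is_splitting_field K L g"
    and "inj (($) \<alpha>)" and "range (($) \<alpha>) = {x. poly g x = 0}"
    and "\<eta>\<^sub>2 = 2 * inverse b" and "\<eta>\<^sub>1 = 2 * a * inverse b"
    and "k = (n - 1) div 2"
    and "S\<^sub>1 = {(\<Sum>i<k. monom (f i) i) +
                smult (f (k - 1)) (monom \<eta>\<^sub>1 k + monom \<eta>\<^sub>2 (k + 1)) | f. True}"
    and "\<And>I :: 'n set. card I = k \<Longrightarrow>
           \<eta>\<^sub>1 * locator_coeff \<alpha> k I 1 +
           \<eta>\<^sub>2 * (locator_coeff \<alpha> k I 2 - (locator_coeff \<alpha> k I 1)\<^sup>2) \<noteq> 1"
  shows "(\<exists>v :: 'F ^ 'n. \<forall>i. (v $ i)\<^sup>2 = inverse (poly (pderiv g) (\<alpha> $ i))) \<and>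
         (\<forall>v :: 'F ^ 'n. (\<forall>i. (v $ i)\<^sup>2 = inverse (poly (pderiv g) (\<alpha> $ i))) \<longrightarrow>
            self_orthogonal_MDS_TGRS n ((n - 1) div 2) ((n + 3) div 2) (ev \<alpha> v ` S\<^sub>1)) \<and>
         (\<exists>C :: ('F ^ 'n) set.
            self_orthogonal_MDS_TGRS n ((n - 1) div 2) ((n + 3) div 2) C)"
proof -
  note g = assms(25) and \<alpha> = assms(27) and roots = assms(28)
  have "p \<ge> 3"
    using prime_ge_2_nat[OF \<open>prime p\<close>] \<open>odd p\<close> by (cases "p = 2") auto
  also have "p \<le> p ^ s"
    using \<open>p \<ge> 3\<close> \<open>s > 0\<close> by (intro self_le_power) auto
  also have "\<dots> \<le> n"
    using \<open>r > 0\<close> \<open>n = r * p ^ s\<close> by simp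
  finally have "n \<ge> 3" .
  have "odd n"
    using \<open>odd p\<close> \<open>odd r\<close> \<open>n = r * p ^ s\<close> by simp
  then have k: "n = 2 * k + 1" "k > 0"
    using \<open>n \<ge> 3\<close> \<open>k = (n - 1) div 2\<close> by (auto elim!: oddE)
  \<comment> \<open>Since \<open>n \<ge> 3\<close>, the exponents \<open>n\<close>,
    \<open>n - 1\<close>, \<open>n - 2\<close> and 0 are distinct, so \<open>c\<close> does not
    interfere with \<open>b\<close>.\<close>
  have coeff_g: "coeff g n = 1" "coeff g (n - 1) = a" "coeff g (n - 2) = b"
    using k unfolding g by (auto simp: coeff_pCons split: nat.splits)
  have "degree g \<le> n"
    unfolding g by (intro degree_le) (auto simp: coeff_pCons split: nat.splits)
  have "g \<noteq> 0" using coeff_g(1) by auto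

  \<comment> \<open>Both sides have degree at most \<open>n\<close>, the same coefficient 1 in
    degree \<open>n\<close>, and equal values at \<open>n\<close> distinct points.\<close>
  have g_eq: "g = (\<Prod>i\<in>UNIV. [:- (\<alpha> $ i), 1:])"
  proof (rule poly_eqI_degree_lead_coeff[of _ n _ "range (($) \<alpha>)"])
    show "coeff g n = coeff (\<Prod>i\<in>UNIV. [:- (\<alpha> $ i), 1:]) n"
      using coeff_locator_card[of "($) \<alpha>" UNIV] coeff_g(1) \<open>CARD('n) = n\<close> by simp
    fix z assume z: "z \<in> range (($) \<alpha>)"
    then have "poly (\<Prod>i\<in>UNIV. [:- (\<alpha> $ i), 1:]) z = 0"
      by (subst poly_locator_eq_0_iff) auto
    then show "poly g z = poly (\<Prod>i\<in>UNIV. [:- (\<alpha> $ i), 1:]) z"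
      using z roots by auto
  qed (use \<open>degree g \<le> n\<close> \<open>CARD('n) = n\<close> big_range_inj(3)[OF \<alpha>] in \<open>auto simp: degree_locator\<close>)
  have g_range: "g = (\<Prod>x\<in>range (($) \<alpha>). [:- x, 1:])"
    by (simp add: g_eq big_range_inj[OF \<alpha>])
  have g'_nz: "poly (pderiv g) (\<alpha> $ i) \<noteq> 0" for i
    unfolding g_range by (subst poly_pderiv_locator) auto

  have L: "is_subfield L" "poly_over L g" "splits_in L g"
    using assms(26) by (auto simp: is_splitting_field_def poly_over_def)
  have "\<exists>y. y\<^sup>2 = inverse (poly (pderiv g) (\<alpha> $ i))" for i
  proof (rule subfield_square_root_exists[OF L(1) \<open>card L = q\<close> \<open>CARD('F) = q\<^sup>2\<close>])
    show "odd q" using \<open>odd p\<close> \<open>q = p ^ h\<close> by simp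
    have "\<alpha> $ i \<in> L"
      using splits_in_root[OF L(3) \<open>g \<noteq> 0\<close>] roots by blast
    then have "poly (pderiv g) (\<alpha> $ i) \<in> L"
      using L by (intro subfield_poly poly_over_pderiv)
    then show "inverse (poly (pderiv g) (\<alpha> $ i)) \<in> L"
      using L(1) by (simp add: is_subfield_def)
  qed
  then obtain w where w: "\<And>i. (w i)\<^sup>2 = inverse (poly (pderiv g) (\<alpha> $ i))"
    by metis
  then have ex: "\<exists>v :: 'F ^ 'n. \<forall>i. (v $ i)\<^sup>2 = inverse (poly (pderiv g) (\<alpha> $ i))"
    by (intro exI[of _ "\<chi> i. w i"]) simp

  have all: "self_orthogonal_MDS_TGRS n ((n - 1) div 2) ((n + 3) div 2) (ev \<alpha> v ` S\<^sub>1)"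
    if v: "\<forall>i. (v $ i)\<^sup>2 = inverse (poly (pderiv g) (\<alpha> $ i))" for v
  proof -
    have v_nz: "\<forall>i. v $ i \<noteq> 0"
      using v g'_nz by (metis inverse_zero_imp_zero zero_power2)
    have S: "S\<^sub>1 = two_twist_polys k \<eta>\<^sub>1 \<eta>\<^sub>2"
      using two_twist_polys_eq[OF k(2), of \<eta>\<^sub>1 \<eta>\<^sub>2] assms(32) by simp
    have "is_code CARD('n) k (CARD('n) - k + 1) (ev \<alpha> v ` S\<^sub>1)"
      unfolding S using k \<alpha> v_nz assms(33) \<open>CARD('n) = n\<close> by (intro two_twist_is_code) auto
    then have code: "is_code n k (n - k + 1) (ev \<alpha> v ` S\<^sub>1)"
      using \<open>CARD('n) = n\<close> by simp
    then have MDS: "is_MDS (ev \<alpha> v ` S\<^sub>1)"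
      unfolding is_MDS_def by blast
    have TGRS: "is_TGRS k (ev \<alpha> v ` S\<^sub>1)"
      unfolding S using k \<alpha> v_nz \<open>CARD('n) = n\<close> by (intro two_twist_is_TGRS) auto
    have "self_orthogonal (ev \<alpha> v ` S\<^sub>1)"
      unfolding S \<open>\<eta>\<^sub>1 = _\<close> \<open>\<eta>\<^sub>2 = _\<close>
      by (rule two_twist_self_orthogonal)
        (use k \<alpha> v coeff_g \<open>CARD('n) = n\<close> \<open>b \<noteq> 0\<close> in \<open>simp_all flip: g_eq\<close>)
    \<comment> \<open>With \<open>n = 2 * k + 1\<close> both expressions for the distance equal
      \<open>k + 2\<close>, the Singleton bound.\<close>
    moreover have "(n - 1) div 2 = k" "(n + 3) div 2 = n - k + 1"
      using k(1) by auto
    ultimately show ?thesis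
      using code MDS TGRS by (simp add: self_orthogonal_MDS_TGRS_def)
  qed
  show ?thesis using ex all by blast
qed

end
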